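(* Let $\pi=\pi_1+i\pi_2\in\Gamma(\wedge^2T_{\mathbb C}M)$ be a complex bivector on a smooth manifold $M$ ($\pi_1,\pi_2$ real bivectors), and let $L_\pi$ be its graph. The real part $K_\pi=L_\pi\cap\mathbb TM$ of $L_\pi$ is $$K_\pi=\mathrm{graph}(\pi_1|_{\ker\pi_2})=\{\pi_1^\sharp(\xi)+\xi : \xi\in\ker\pi_2\}=e^{\pi_1}\ker\pi_2 .$$ Moreover, the real index of $L_\pi$ is $\operatorname{rank}\ker\pi_2$ (pointwise on $M$).
   Context: $\mathbb TM=TM\oplus T^*M$, $T_{\mathbb C}M=TM\otimes\mathbb C$, $T^*_{\mathbb C}M=T^*M\otimes\mathbb C$. $L_\pi=\{\pi^\sharp(\alpha)+\alpha : \alpha\in T^*_{\mathbb C}M\}\subseteq\mathbb TM\otimes\mathbb C$, where $\pi^\sharp(\xi+i\eta)=\pi_1^\sharp\xi-\pi_2^\sharp\eta+i(\pi_2^\sharp\xi+\pi_1^\sharp\eta)$. $\ker\pi_2$ is the kernel of $\pi_2^\sharp:T^*M\to TM$. For a bivector $\beta$ and a subset $S$ of $\mathbb TM$, $e^\beta S=\{X+\beta^\sharp(\xi)+\xi : X+\xi\in S\}$. The real index of $L_\pi$ is the function $p\mapsto\dim_{\mathbb R}K_\pi|_p$. *)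

theory Defs
  imports "HOL-Analysis.Analysis" "HOL-Library.Function_Algebras"
begin

text \<open>Pointwise real vector space structure on functions; tangent vectors and covectors are
  functions below.\<close>

instantiation "fun" :: (type, real_vector) real_vector
begin
definition scaleR_fun :: "real \<Rightarrow> ('a \<Rightarrow> 'b) \<Rightarrow> 'a \<Rightarrow> 'b"
  where "scaleR_fun c f = (\<lambda>x. c *\<^sub>R f x)"
instance
  by standard (auto simp: scaleR_fun_def plus_fun_def algebra_simps)
end

section \<open>Smooth manifolds\<close>

text \<open>The model space of dimension \<open>n\<close> is \<open>Euclidean_space n\<close>, whose points are the
  \<open>x :: nat \<Rightarrow> real\<close> with \<open>x i = 0\<close> for \<open>i \<ge> n\<close>. Below, \<open>V\<close> is always an open subset of it.\<close>

definition partial :: "nat \<Rightarrow> ((nat \<Rightarrow> real) \<Rightarrow> real) \<Rightarrow> (nat \<Rightarrow> real) \<Rightarrow> real"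
  where "partial i f x = deriv (\<lambda>t. f (x(i := t))) (x i)"

fun Ck_on :: "nat \<Rightarrow> nat \<Rightarrow> (nat \<Rightarrow> real) set \<Rightarrow> ((nat \<Rightarrow> real) \<Rightarrow> real) \<Rightarrow> bool" where
  "Ck_on n 0 V f \<longleftrightarrow> continuous_map (subtopology (Euclidean_space n) V) euclideanreal f"
| "Ck_on n (Suc k) V f \<longleftrightarrow>
     continuous_map (subtopology (Euclidean_space n) V) euclideanreal f \<and>
     (\<forall>i<n. (\<forall>x\<in>V. (\<lambda>t. f (x(i := t))) field_differentiable (at (x i))) \<and>
            Ck_on n k V (partial i f))"

definition smooth_fun_on :: "nat \<Rightarrow> (nat \<Rightarrow> real) set \<Rightarrow> ((nat \<Rightarrow> real) \<Rightarrow> real) \<Rightarrow> bool"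
  where "smooth_fun_on n V f \<longleftrightarrow> (\<forall>k. Ck_on n k V f)"

text \<open>A chart is a pair \<open>(U, \<phi>)\<close> of a domain and a coordinate map. The atlas need not be maximal.\<close>

type_synonym 'a chart = "'a set \<times> ('a \<Rightarrow> nat \<Rightarrow> real)"

record 'a manifold =
  mtop :: "'a topology"
  mdim :: nat
  atlas :: "'a chart set"

abbreviation points :: "'a manifold \<Rightarrow> 'a set"
  where "points M \<equiv> topspace (mtop M)"

definition smooth_manifold :: "'a manifold \<Rightarrow> bool" where
  "smooth_manifold M \<longleftrightarrow>
     Hausdorff_space (mtop M) \<and> second_countable (mtop M) \<and>
     (\<Union>(U, \<phi>)\<in>atlas M. U) = points M \<and>
     (\<forall>(U, \<phi>)\<in>atlas M.
        openin (mtop M) U \<and> openin (Euclidean_space (mdim M)) (\<phi> ` U) \<and>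
        homeomorphic_map (subtopology (mtop M) U)
          (subtopology (Euclidean_space (mdim M)) (\<phi> ` U)) \<phi>) \<and>
     (\<forall>(U, \<phi>)\<in>atlas M. \<forall>(V, \<psi>)\<in>atlas M. \<forall>i<mdim M.
        smooth_fun_on (mdim M) (\<phi> ` (U \<inter> V)) (\<lambda>x. \<psi> (inv_into U \<phi> x) i))"

definition smooth_in_chart :: "'a manifold \<Rightarrow> 'a chart \<Rightarrow> ('a \<Rightarrow> real) \<Rightarrow> bool"
  where "smooth_in_chart M = (\<lambda>(U, \<phi>) f. smooth_fun_on (mdim M) (\<phi> ` U) (f \<circ> inv_into U \<phi>))"

text \<open>Functions on \<open>M\<close> are extended by \<open>0\<close> outside \<open>points M\<close>. Likewise a tangent vector, being a
  functional on \<open>smooth_functions M\<close>, is extended by \<open>0\<close> to all functions, and a covector is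
  extended by \<open>0\<close> outside the tangent space. This makes equality of these objects the intended one.\<close>

definition smooth_functions :: "'a manifold \<Rightarrow> ('a \<Rightarrow> real) set" where
  "smooth_functions M =
     {f. (\<forall>x. x \<notin> points M \<longrightarrow> f x = 0) \<and> (\<forall>C\<in>atlas M. smooth_in_chart M C f)}"

section \<open>Tangent and cotangent spaces\<close>

type_synonym 'a tvec = "('a \<Rightarrow> real) \<Rightarrow> real"
type_synonym 'a covec = "'a tvec \<Rightarrow> real"

text \<open>Tangent vectors are the derivations of the algebra of smooth functions at \<open>p\<close>.\<close>

definition tangent_space :: "'a manifold \<Rightarrow> 'a \<Rightarrow> 'a tvec set" where
  "tangent_space M p =
     {v. (\<forall>f\<in>smooth_functions M. \<forall>g\<in>smooth_functions M.
            v (\<lambda>x. f x + g x) = v f + v g \<and>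
            v (\<lambda>x. f x * g x) = f p * v g + g p * v f) \<and>
         (\<forall>f\<in>smooth_functions M. \<forall>c. v (\<lambda>x. c * f x) = c * v f) \<and>
         (\<forall>f. f \<notin> smooth_functions M \<longrightarrow> v f = 0)}"

definition cotangent_space :: "'a manifold \<Rightarrow> 'a \<Rightarrow> 'a covec set" where
  "cotangent_space M p =
     {\<xi>. (\<forall>v\<in>tangent_space M p. \<forall>w\<in>tangent_space M p. \<xi> (v + w) = \<xi> v + \<xi> w) \<and>
         (\<forall>v\<in>tangent_space M p. \<forall>c. \<xi> (c *\<^sub>R v) = c * \<xi> v) \<and>
         (\<forall>v. v \<notin> tangent_space M p \<longrightarrow> \<xi> v = 0)}"

definition differential :: "'a manifold \<Rightarrow> 'a \<Rightarrow> ('a \<Rightarrow> real) \<Rightarrow> 'a covec"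
  where "differential M p f = (\<lambda>v. if v \<in> tangent_space M p then v f else 0)"

text \<open>The fibre at \<open>p\<close> of the generalized tangent bundle \<open>TM \<oplus> T\<^sup>*M\<close>; \<open>X + \<xi>\<close> is \<open>(X, \<xi>)\<close>.\<close>

definition gen_tangent_space :: "'a manifold \<Rightarrow> 'a \<Rightarrow> ('a tvec \<times> 'a covec) set"
  where "gen_tangent_space M p = tangent_space M p \<times> cotangent_space M p"

text \<open>The coordinate vector \<open>\<partial>/\<partial>x\<^sub>i\<close> at \<open>p\<close>.\<close>

definition coord_vector :: "'a manifold \<Rightarrow> 'a chart \<Rightarrow> 'a \<Rightarrow> nat \<Rightarrow> 'a tvec" where
  "coord_vector M = (\<lambda>(U, \<phi>) p i f.
     if f \<in> smooth_functions M then partial i (f \<circ> inv_into U \<phi>) (\<phi> p) else 0)"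

section \<open>Complexification\<close>

text \<open>For a real vector space \<open>V\<close>, the element \<open>v + i w\<close> of \<open>V \<otimes> \<complex>\<close> is the pair \<open>(v, w)\<close>.\<close>

definition complexification :: "'v set \<Rightarrow> ('v \<times> 'v) set"
  where "complexification V = V \<times> V"

definition cscale :: "complex \<Rightarrow> 'v::real_vector \<times> 'v \<Rightarrow> 'v \<times> 'v"
  where "cscale z = (\<lambda>(v, w). (Re z *\<^sub>R v - Im z *\<^sub>R w, Im z *\<^sub>R v + Re z *\<^sub>R w))"

definition of_real_vector :: "'v::real_vector \<Rightarrow> 'v \<times> 'v"
  where "of_real_vector v = (v, 0)"

definition ceval :: "'a covec \<times> 'a covec \<Rightarrow> 'a tvec \<Rightarrow> complex"
  where "ceval = (\<lambda>(\<xi>, \<eta>) v. Complex (\<xi> v) (\<eta> v))"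

section \<open>Bivectors\<close>

text \<open>An element of \<open>\<Lambda>\<^sup>2 V\<close>, \<open>V\<close> finite-dimensional, is identified with the alternating bilinear form
  on \<open>V\<^sup>*\<close> it defines, where \<open>(X \<and> Y) (\<xi>, \<eta>) = \<xi> X * \<eta> Y - \<xi> Y * \<eta> X\<close>.\<close>

type_synonym 'a bivec = "'a covec \<Rightarrow> 'a covec \<Rightarrow> real"
type_synonym 'a cbivec = "'a covec \<times> 'a covec \<Rightarrow> 'a covec \<times> 'a covec \<Rightarrow> complex"

definition bivector_at :: "'a manifold \<Rightarrow> 'a \<Rightarrow> 'a bivec \<Rightarrow> bool" where
  "bivector_at M p b \<longleftrightarrow>
     (\<forall>\<xi>\<in>cotangent_space M p. \<forall>\<eta>\<in>cotangent_space M p. \<forall>\<zeta>\<in>cotangent_space M p. \<forall>c.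
        b (\<xi> + \<eta>) \<zeta> = b \<xi> \<zeta> + b \<eta> \<zeta> \<and> b (c *\<^sub>R \<xi>) \<zeta> = c * b \<xi> \<zeta> \<and>
        b \<zeta> (\<xi> + \<eta>) = b \<zeta> \<xi> + b \<zeta> \<eta> \<and> b \<zeta> (c *\<^sub>R \<xi>) = c * b \<zeta> \<xi> \<and>
        b \<xi> \<xi> = 0)"

definition cbivector_at :: "'a manifold \<Rightarrow> 'a \<Rightarrow> 'a cbivec \<Rightarrow> bool" where
  "cbivector_at M p b \<longleftrightarrow>
     (\<forall>\<alpha>\<in>complexification (cotangent_space M p).
      \<forall>\<beta>\<in>complexification (cotangent_space M p).
      \<forall>\<gamma>\<in>complexification (cotangent_space M p). \<forall>z.
        b (\<alpha> + \<beta>) \<gamma> = b \<alpha> \<gamma> + b \<beta> \<gamma> \<and> b (cscale z \<alpha>) \<gamma> = z * b \<alpha> \<gamma> \<and>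
        b \<gamma> (\<alpha> + \<beta>) = b \<gamma> \<alpha> + b \<gamma> \<beta> \<and> b \<gamma> (cscale z \<alpha>) = z * b \<gamma> \<alpha> \<and>
        b \<alpha> \<alpha> = 0)"

text \<open>Smoothness of a section of \<open>\<Lambda>\<^sup>2 TM\<close> (respectively \<open>\<Lambda>\<^sup>2 T\<^sub>\<complex>M\<close>): in every chart it equals
  \<open>\<Sum>\<^sub>i\<^sub><\<^sub>j c\<^sub>i\<^sub>j \<partial>\<^sub>i \<and> \<partial>\<^sub>j\<close> with smooth coefficients.\<close>

definition bivector_field :: "'a manifold \<Rightarrow> ('a \<Rightarrow> 'a bivec) \<Rightarrow> bool" where
  "bivector_field M b \<longleftrightarrow>
     (\<forall>p\<in>points M. bivector_at M p (b p)) \<and>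
     (\<forall>C\<in>atlas M. \<exists>c :: nat \<Rightarrow> nat \<Rightarrow> 'a \<Rightarrow> real.
        (\<forall>j<mdim M. \<forall>i<j. smooth_in_chart M C (c i j)) \<and>
        (\<forall>p\<in>fst C. \<forall>\<xi>\<in>cotangent_space M p. \<forall>\<eta>\<in>cotangent_space M p.
           b p \<xi> \<eta> = (\<Sum>j<mdim M. \<Sum>i<j. c i j p *
             (\<xi> (coord_vector M C p i) * \<eta> (coord_vector M C p j)
              - \<xi> (coord_vector M C p j) * \<eta> (coord_vector M C p i)))))"

definition cbivector_field :: "'a manifold \<Rightarrow> ('a \<Rightarrow> 'a cbivec) \<Rightarrow> bool" where
  "cbivector_field M b \<longleftrightarrow>
     (\<forall>p\<in>points M. cbivector_at M p (b p)) \<and>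
     (\<forall>C\<in>atlas M. \<exists>c :: nat \<Rightarrow> nat \<Rightarrow> 'a \<Rightarrow> complex.
        (\<forall>j<mdim M. \<forall>i<j. smooth_in_chart M C (\<lambda>p. Re (c i j p)) \<and>
                             smooth_in_chart M C (\<lambda>p. Im (c i j p))) \<and>
        (\<forall>p\<in>fst C. \<forall>\<alpha>\<in>complexification (cotangent_space M p).
                    \<forall>\<beta>\<in>complexification (cotangent_space M p).
           b p \<alpha> \<beta> = (\<Sum>j<mdim M. \<Sum>i<j. c i j p *
             (ceval \<alpha> (coord_vector M C p i) * ceval \<beta> (coord_vector M C p j)
              - ceval \<alpha> (coord_vector M C p j) * ceval \<beta> (coord_vector M C p i)))))"

text \<open>\<open>\<pi> = \<pi>\<^sub>1 + i \<pi>\<^sub>2\<close>. Both sides are complex bilinear on \<open>T\<^sup>*M \<otimes> \<complex>\<close>, so it is enough to compare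
  them on real covectors.\<close>

definition has_real_imag_parts ::
  "'a manifold \<Rightarrow> ('a \<Rightarrow> 'a cbivec) \<Rightarrow> ('a \<Rightarrow> 'a bivec) \<Rightarrow> ('a \<Rightarrow> 'a bivec) \<Rightarrow> bool" where
  "has_real_imag_parts M \<pi> \<pi>1 \<pi>2 \<longleftrightarrow>
     (\<forall>p\<in>points M. \<forall>\<xi>\<in>cotangent_space M p. \<forall>\<eta>\<in>cotangent_space M p.
        \<pi> p (of_real_vector \<xi>) (of_real_vector \<eta>) = Complex (\<pi>1 p \<xi> \<eta>) (\<pi>2 p \<xi> \<eta>))"

text \<open>\<open>b\<^sup>\<sharp> \<xi>\<close> is the vector \<open>b (\<xi>, \<cdot>)\<close>; as a derivation it maps \<open>f\<close> to \<open>df (b\<^sup>\<sharp> \<xi>) = b (\<xi>, df)\<close>.\<close>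

definition sharp :: "'a manifold \<Rightarrow> 'a \<Rightarrow> 'a bivec \<Rightarrow> 'a covec \<Rightarrow> 'a tvec" where
  "sharp M p b \<xi> = (\<lambda>f. if f \<in> smooth_functions M then b \<xi> (differential M p f) else 0)"

definition csharp ::
  "'a manifold \<Rightarrow> 'a \<Rightarrow> 'a cbivec \<Rightarrow> 'a covec \<times> 'a covec \<Rightarrow> 'a tvec \<times> 'a tvec" where
  "csharp M p b \<alpha> =
     ((\<lambda>f. if f \<in> smooth_functions M
            then Re (b \<alpha> (of_real_vector (differential M p f))) else 0),
      (\<lambda>f. if f \<in> smooth_functions M
            then Im (b \<alpha> (of_real_vector (differential M p f))) else 0))"

text \<open>The formula \<open>\<pi>\<^sup>\<sharp> (\<xi> + i \<eta>) = \<pi>\<^sub>1\<^sup>\<sharp> \<xi> - \<pi>\<^sub>2\<^sup>\<sharp> \<eta> + i (\<pi>\<^sub>2\<^sup>\<sharp> \<xi> + \<pi>\<^sub>1\<^sup>\<sharp> \<eta>)\<close>.\<close>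

lemma differential_in_cotangent_space: "differential M p f \<in> cotangent_space M p"
  if "f \<in> smooth_functions M"
proof -
  have "v + w \<in> tangent_space M p" if "v \<in> tangent_space M p" "w \<in> tangent_space M p" for v w
    using that unfolding tangent_space_def by (auto simp: algebra_simps)
  moreover have "c *\<^sub>R v \<in> tangent_space M p" if "v \<in> tangent_space M p" for v c
    using that unfolding tangent_space_def by (auto simp: algebra_simps scaleR_fun_def)
  ultimately show ?thesis
    unfolding cotangent_space_def differential_def by (auto simp: scaleR_fun_def)
qed

lemma csharp_real_imag:
  assumes \<pi>: "cbivector_field M \<pi>" "has_real_imag_parts M \<pi> \<pi>1 \<pi>2" and p: "p \<in> points M"
    and \<xi>: "\<xi> \<in> cotangent_space M p" and \<eta>: "\<eta> \<in> cotangent_space M p"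
  shows "csharp M p (\<pi> p) (\<xi>, \<eta>) =
    (sharp M p (\<pi>1 p) \<xi> - sharp M p (\<pi>2 p) \<eta>, sharp M p (\<pi>2 p) \<xi> + sharp M p (\<pi>1 p) \<eta>)"
proof -
  have b: "cbivector_at M p (\<pi> p)"
    using \<pi>(1) p by (simp add: cbivector_field_def)
  have zero: "0 \<in> cotangent_space M p"
    unfolding cotangent_space_def by auto
  have eq: "(\<xi>, \<eta>) = of_real_vector \<xi> + cscale \<i> (of_real_vector \<eta>)"
    by (simp add: of_real_vector_def cscale_def)
  have "\<pi> p (\<xi>, \<eta>) (of_real_vector \<zeta>) =
      Complex (\<pi>1 p \<xi> \<zeta>) (\<pi>2 p \<xi> \<zeta>) + \<i> * Complex (\<pi>1 p \<eta> \<zeta>) (\<pi>2 p \<eta> \<zeta>)"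
    if \<zeta>: "\<zeta> \<in> cotangent_space M p" for \<zeta>
  proof -
    have r: "of_real_vector \<tau> \<in> complexification (cotangent_space M p)"
      if "\<tau> \<in> cotangent_space M p" for \<tau>
      using that zero by (auto simp: of_real_vector_def complexification_def)
    have i: "cscale \<i> (of_real_vector \<eta>) \<in> complexification (cotangent_space M p)"
      using \<eta> zero by (auto simp: of_real_vector_def complexification_def cscale_def)
    have "\<pi> p (of_real_vector \<xi> + cscale \<i> (of_real_vector \<eta>)) (of_real_vector \<zeta>) =
        \<pi> p (of_real_vector \<xi>) (of_real_vector \<zeta>) +
        \<pi> p (cscale \<i> (of_real_vector \<eta>)) (of_real_vector \<zeta>)"
      using b r[OF \<xi>] i r[OF \<zeta>] unfolding cbivector_at_def by (auto simp only:)
    moreover have "\<pi> p (cscale \<i> (of_real_vector \<eta>)) (of_real_vector \<zeta>) =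
        \<i> * \<pi> p (of_real_vector \<eta>) (of_real_vector \<zeta>)"
      using b r[OF \<eta>] r[OF \<zeta>] unfolding cbivector_at_def by (auto simp only:)
    ultimately have "\<pi> p (\<xi>, \<eta>) (of_real_vector \<zeta>) =
        \<pi> p (of_real_vector \<xi>) (of_real_vector \<zeta>) + \<i> * \<pi> p (of_real_vector \<eta>) (of_real_vector \<zeta>)"
      by (simp add: eq)
    then show ?thesis
      using \<pi> p \<xi> \<eta> \<zeta> unfolding has_real_imag_parts_def by simp
  qed
  then show ?thesis
    by (simp add: csharp_def sharp_def fun_eq_iff differential_in_cotangent_space)
qed

definition ker_sharp :: "'a manifold \<Rightarrow> 'a \<Rightarrow> 'a bivec \<Rightarrow> 'a covec set"
  where "ker_sharp M p b = {\<xi>\<in>cotangent_space M p. sharp M p b \<xi> = 0}"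

definition graph_over :: "('a covec \<Rightarrow> 'a tvec) \<Rightarrow> 'a covec set \<Rightarrow> ('a tvec \<times> 'a covec) set"
  where "graph_over F S = (\<lambda>\<xi>. (F \<xi>, \<xi>)) ` S"

definition exp_bivector ::
  "'a manifold \<Rightarrow> 'a \<Rightarrow> 'a bivec \<Rightarrow> ('a tvec \<times> 'a covec) set \<Rightarrow> ('a tvec \<times> 'a covec) set"
  where "exp_bivector M p b S = {(X + sharp M p b \<xi>, \<xi>) | X \<xi>. (X, \<xi>) \<in> S}"

section \<open>The graph of a complex bivector, real part and real index\<close>

text \<open>The element \<open>(X + i Y) + (\<xi> + i \<eta>)\<close> of \<open>(TM \<oplus> T\<^sup>*M) \<otimes> \<complex>\<close> is \<open>((X, \<xi>), (Y, \<eta>))\<close>.\<close>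

definition cgraph :: "'a manifold \<Rightarrow> ('a \<Rightarrow> 'a cbivec) \<Rightarrow> 'a \<Rightarrow>
    (('a tvec \<times> 'a covec) \<times> ('a tvec \<times> 'a covec)) set" where
  "cgraph M \<pi> p =
     {((X, \<xi>), (Y, \<eta>)) | X Y \<xi> \<eta>.
        (\<xi>, \<eta>) \<in> complexification (cotangent_space M p) \<and> (X, Y) = csharp M p (\<pi> p) (\<xi>, \<eta>)}"

text \<open>\<open>K = L \<inter> (TM \<oplus> T\<^sup>*M)\<close>, as a subset of the real bundle \<open>TM \<oplus> T\<^sup>*M\<close>.\<close>

definition real_part :: "'a manifold \<Rightarrow>
    ('a \<Rightarrow> (('a tvec \<times> 'a covec) \<times> ('a tvec \<times> 'a covec)) set) \<Rightarrow> 'a \<Rightarrow> ('a tvec \<times> 'a covec) set"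
  where "real_part M L p = {e\<in>gen_tangent_space M p. of_real_vector e \<in> L p}"

definition real_index :: "'a manifold \<Rightarrow>
    ('a \<Rightarrow> (('a tvec \<times> 'a covec) \<times> ('a tvec \<times> 'a covec)) set) \<Rightarrow> 'a \<Rightarrow> nat"
  where "real_index M L p = dim (real_part M L p)"

end

theory Submission
  imports Defs
begin

text \<open>A real element of \<open>L\<^sub>\<pi>\<close> is \<open>\<pi>\<^sup>\<sharp>(\<xi>) + \<xi>\<close> with \<open>\<xi>\<close> real, whose imaginary part is \<open>\<pi>\<^sub>2\<^sup>\<sharp> \<xi>\<close>; so it
  is real exactly when \<open>\<xi> \<in> ker \<pi>\<^sub>2\<close>, and then it equals \<open>\<pi>\<^sub>1\<^sup>\<sharp>(\<xi>) + \<xi>\<close>. The projection to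
  \<open>T\<^sup>*M\<close> is injective on a graph, so it identifies the fibre of the real part with \<open>ker \<pi>\<^sub>2\<close>.
  That \<open>\<pi>\<^sub>1\<^sup>\<sharp> \<xi>\<close> is a derivation uses that the smooth functions form an algebra.\<close>

section \<open>The algebra of smooth functions\<close>

text \<open>\<open>partial\<close> differentiates along the line
  \<open>t \<mapsto> x(i := t)\<close>. As \<open>i < n\<close>, this line stays in the model space,
  so by continuity it stays in the open set \<open>V\<close> for \<open>t\<close> near
  \<open>x i\<close>. This makes partial derivatives local to \<open>V\<close>.\<close>

lemma eventually_fun_upd_in_openin_Euclidean:
  assumes V: "openin (Euclidean_space n) V" and x: "x \<in> V" and i: "i < n"
  shows "\<forall>\<^sub>F t in nhds (x i). x(i := t) \<in> V"
proof -
  have x0: "x j = 0" if "j \<ge> n" for j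
    using openin_subset[OF V] x that by (auto simp: topspace_Euclidean_space)
  have "continuous_map euclideanreal (powertop_real UNIV) (\<lambda>t. x(i := t))"
    by (auto simp: continuous_map_componentwise_UNIV fun_upd_def)
  then have "continuous_map euclideanreal (Euclidean_space n) (\<lambda>t. x(i := t))"
    using i x0 by (auto simp: Euclidean_space_def continuous_map_in_subtopology)
  then have "openin euclideanreal {t \<in> topspace euclideanreal. x(i := t) \<in> V}"
    using V by (rule openin_continuous_map_preimage)
  then have "open {t. x(i := t) \<in> V}" by simp
  from eventually_nhds_in_open[OF this, of "x i"] show ?thesis
    using x by simp
qed

lemma partial_cong:
  assumes "openin (Euclidean_space n) V" "x \<in> V" "i < n" and "\<And>y. y \<in> V \<Longrightarrow> f y = g y"
  shows "partial i f x = partial i g x"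
  unfolding partial_def
  by (rule deriv_cong_ev[OF _ refl])
    (rule eventually_mono[OF eventually_fun_upd_in_openin_Euclidean[OF assms(1-3)]], rule assms(4))

text \<open>Needed because the sum and product rules for \<open>partial\<close> are available only
  at points of \<open>V\<close>, where differentiability is assumed, whereas \<open>Ck_on\<close>
  recurses on functions on the whole type.\<close>

lemma Ck_on_cong:
  assumes V: "openin (Euclidean_space n) V"
    and "\<And>x. x \<in> V \<Longrightarrow> f x = g x" and "Ck_on n k V f"
  shows "Ck_on n k V g"
  using assms(2,3)
proof (induction k arbitrary: f g)
  case 0
  then show ?case by (auto intro: continuous_map_eq[of _ _ f g])
next
  case (Suc k)
  have "(\<lambda>t. g (x(i := t))) field_differentiable at (x i)" if i: "i < n" and x: "x \<in> V" for i x
  proof -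
    have ev: "\<forall>\<^sub>F t in nhds (x i). f (x(i := t)) = g (x(i := t))"
      by (rule eventually_mono[OF eventually_fun_upd_in_openin_Euclidean[OF V x i]])
        (rule Suc.prems(1))
    obtain D where "((\<lambda>t. f (x(i := t))) has_field_derivative D) (at (x i))"
      using Suc.prems(2) i x by (auto simp: field_differentiable_def)
    then show ?thesis
      unfolding DERIV_cong_ev[OF refl ev refl] field_differentiable_def by blast
  qed
  moreover have "Ck_on n k V (partial i g)" if i: "i < n" for i
  proof (rule Suc.IH)
    show "partial i f x = partial i g x" if "x \<in> V" for x
      by (rule partial_cong[OF V that i Suc.prems(1)])
    show "Ck_on n k V (partial i f)"
      using Suc.prems(2) i by simp
  qed
  moreover have "continuous_map (subtopology (Euclidean_space n) V) euclideanreal g"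
    by (rule continuous_map_eq[of _ _ f]) (use Suc.prems in auto)
  ultimately show ?case by simp
qed

lemma Ck_on_Suc_imp_Ck_on: "Ck_on n (Suc k) V f \<Longrightarrow> Ck_on n k V f"
  by (induction k arbitrary: f) auto

lemma partial_add:
  assumes "(\<lambda>t. f (x(i := t))) field_differentiable at (x i)"
    and "(\<lambda>t. g (x(i := t))) field_differentiable at (x i)"
  shows "partial i (\<lambda>y. f y + g y) x = partial i f x + partial i g x"
  using assms by (simp add: partial_def)

lemma partial_mult:
  assumes "(\<lambda>t. f (x(i := t))) field_differentiable at (x i)"
    and "(\<lambda>t. g (x(i := t))) field_differentiable at (x i)"
  shows "partial i (\<lambda>y. f y * g y) x = f x * partial i g x + partial i f x * g x"
  using assms by (simp add: partial_def)

lemma Ck_on_add: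
  assumes V: "openin (Euclidean_space n) V" and "Ck_on n k V f" "Ck_on n k V g"
  shows "Ck_on n k V (\<lambda>x. f x + g x)"
  using assms(2,3)
proof (induction k arbitrary: f g)
  case 0
  then show ?case by (simp add: continuous_map_add)
next
  case (Suc k)
  have "Ck_on n k V (partial i (\<lambda>x. f x + g x))" if "i < n" for i
    by (rule Ck_on_cong[OF V _ Suc.IH[of "partial i f" "partial i g"]])
      (use Suc.prems that in \<open>auto simp: partial_add\<close>)
  then show ?case
    using Suc.prems by (auto intro: continuous_map_add field_differentiable_add)
qed

lemma Ck_on_mult:
  assumes V: "openin (Euclidean_space n) V" and "Ck_on n k V f" "Ck_on n k V g"
  shows "Ck_on n k V (\<lambda>x. f x * g x)"
  using assms(2,3)
proof (induction k arbitrary: f g)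
  case 0
  then show ?case by (simp add: continuous_map_real_mult)
next
  case (Suc k)
  have "Ck_on n k V (partial i (\<lambda>x. f x * g x))" if "i < n" for i
  proof (rule Ck_on_cong[OF V])
    show "Ck_on n k V (\<lambda>x. f x * partial i g x + partial i f x * g x)"
      \<comment> \<open>The undifferentiated factors \<open>f\<close> and \<open>g\<close> have
        order \<open>Suc k\<close>; the induction hypothesis needs them at order
        \<open>k\<close>.\<close>
      using Suc.prems that Suc.prems[THEN Ck_on_Suc_imp_Ck_on]
      by (intro Ck_on_add[OF V] Suc.IH) simp_all
  qed (use Suc.prems that in \<open>auto simp: partial_mult\<close>)
  then show ?case
    using Suc.prems by (auto intro: continuous_map_real_mult field_differentiable_mult)
qed

lemma Ck_on_const: "Ck_on n k V (\<lambda>x. c)"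
proof (induction k arbitrary: c)
  case (Suc k)
  \<comment> \<open>The constant changes from \<open>c\<close> to \<open>0\<close>, hence the
    generalisation over \<open>c\<close> in the induction.\<close>
  have "partial i (\<lambda>x. c) = (\<lambda>x. 0)" for i
    by (simp add: partial_def fun_eq_iff)
  then show ?case using Suc by simp
qed simp

lemma smooth_functions_add:
  assumes "smooth_manifold M" "f \<in> smooth_functions M" "g \<in> smooth_functions M"
  shows "(\<lambda>x. f x + g x) \<in> smooth_functions M"
  using assms unfolding smooth_functions_def smooth_in_chart_def smooth_fun_on_def smooth_manifold_def
  by (fastforce simp: o_def intro!: Ck_on_add)

lemma smooth_functions_mult:
  assumes "smooth_manifold M" "f \<in> smooth_functions M" "g \<in> smooth_functions M"
  shows "(\<lambda>x. f x * g x) \<in> smooth_functions M"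
  using assms unfolding smooth_functions_def smooth_in_chart_def smooth_fun_on_def smooth_manifold_def
  by (fastforce simp: o_def intro!: Ck_on_mult)

text \<open>A constant function need not vanish off \<open>points M\<close>, so it may fail to lie
  in \<open>smooth_functions M\<close>; the product is therefore formed in the charts.\<close>

lemma smooth_functions_cmult:
  assumes "smooth_manifold M" "f \<in> smooth_functions M"
  shows "(\<lambda>x. c * f x) \<in> smooth_functions M"
  using assms unfolding smooth_functions_def smooth_in_chart_def smooth_fun_on_def smooth_manifold_def
  by (fastforce simp: o_def intro!: Ck_on_mult Ck_on_const)

section \<open>The map \<open>b\<^sup>\<sharp>\<close>\<close>

text \<open>Equality holds on all functionals: on tangent vectors by the derivation laws, elsewhere
  because both sides are 0.\<close>

lemma differential_add:
  assumes "f \<in> smooth_functions M" "g \<in> smooth_functions M"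
  shows "differential M p (\<lambda>x. f x + g x) = differential M p f + differential M p g"
  using assms by (auto simp: differential_def tangent_space_def fun_eq_iff)

lemma differential_mult:
  assumes "f \<in> smooth_functions M" "g \<in> smooth_functions M"
  shows "differential M p (\<lambda>x. f x * g x) =
    f p *\<^sub>R differential M p g + g p *\<^sub>R differential M p f"
  using assms by (auto simp: differential_def tangent_space_def fun_eq_iff scaleR_fun_def)

lemma differential_cmult:
  assumes "f \<in> smooth_functions M"
  shows "differential M p (\<lambda>x. c * f x) = c *\<^sub>R differential M p f"
  using assms by (auto simp: differential_def tangent_space_def fun_eq_iff scaleR_fun_def)

lemma subspace_cotangent_space: "subspace (cotangent_space M p)"
  by (auto simp: subspace_def cotangent_space_def scaleR_fun_def algebra_simps)

lemma bivector_at_add: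
  assumes "bivector_at M p b" "\<xi> \<in> cotangent_space M p" "\<eta> \<in> cotangent_space M p"
    "\<zeta> \<in> cotangent_space M p"
  shows "b (\<xi> + \<eta>) \<zeta> = b \<xi> \<zeta> + b \<eta> \<zeta>" "b \<zeta> (\<xi> + \<eta>) = b \<zeta> \<xi> + b \<zeta> \<eta>"
  using assms unfolding bivector_at_def by blast+

lemma bivector_at_scaleR:
  assumes "bivector_at M p b" "\<xi> \<in> cotangent_space M p" "\<zeta> \<in> cotangent_space M p"
  shows "b (c *\<^sub>R \<xi>) \<zeta> = c * b \<xi> \<zeta>" "b \<zeta> (c *\<^sub>R \<xi>) = c * b \<zeta> \<xi>"
  using assms unfolding bivector_at_def by blast+

text \<open>Linearity of \<open>b\<close> in its second argument carries the linearity and Leibniz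
  rule of \<open>differential\<close> over to \<open>sharp\<close>. Closure of
  \<open>smooth_functions M\<close> keeps sums and products in the nonzero branch of its
  definition.\<close>

lemma sharp_in_tangent_space:
  assumes M: "smooth_manifold M" and b: "bivector_at M p b" and \<xi>: "\<xi> \<in> cotangent_space M p"
  shows "sharp M p b \<xi> \<in> tangent_space M p"
  unfolding tangent_space_def sharp_def
  by (auto simp: smooth_functions_add[OF M] smooth_functions_mult[OF M] smooth_functions_cmult[OF M]
      differential_add differential_mult differential_cmult differential_in_cotangent_space \<xi>
      bivector_at_add[OF b] bivector_at_scaleR[OF b] subspace_scale[OF subspace_cotangent_space])

lemma sharp_add:
  assumes "bivector_at M p b" "\<xi> \<in> cotangent_space M p" "\<eta> \<in> cotangent_space M p"
  shows "sharp M p b (\<xi> + \<eta>) = sharp M p b \<xi> + sharp M p b \<eta>"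
  using assms
  by (auto simp: sharp_def fun_eq_iff bivector_at_add(1) differential_in_cotangent_space)

lemma sharp_scaleR:
  assumes "bivector_at M p b" "\<xi> \<in> cotangent_space M p"
  shows "sharp M p b (c *\<^sub>R \<xi>) = c *\<^sub>R sharp M p b \<xi>"
  using assms
  by (simp add: sharp_def fun_eq_iff bivector_at_scaleR(1) differential_in_cotangent_space
      \<comment> \<open>The instance unfolds only the scaled vector; the covector
        \<open>c *\<^sub>R \<xi>\<close> must stay folded for \<open>bivector_at_scaleR\<close> to
        match.\<close>
      scaleR_fun_def[of c "\<lambda>f. if f \<in> smooth_functions M then _ f else _ f"])

lemma sharp_zero: "bivector_at M p b \<Longrightarrow> sharp M p b 0 = 0"
  using sharp_scaleR[of M p b 0 0] subspace_0[OF subspace_cotangent_space[of M p]] by simp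

lemma subspace_ker_sharp: "bivector_at M p b \<Longrightarrow> subspace (ker_sharp M p b)"
  using subspace_cotangent_space[of M p]
  by (auto simp: subspace_def ker_sharp_def sharp_add sharp_scaleR sharp_zero)

section \<open>Dimension of a graph\<close>

text \<open>The types are merely \<open>real_vector\<close>, so a basis of \<open>S\<close> is
  transported. Injectivity on the span, not just on \<open>S\<close>, preserves
  independence.\<close>

lemma dim_image_inj_on:
  fixes f :: "'a::real_vector \<Rightarrow> 'b::real_vector"
  assumes "linear f" and "inj_on f (span S)"
  shows "dim (f ` S) = dim S"
proof -
  obtain B where B: "B \<subseteq> S" "independent B" "S \<subseteq> span B" "card B = dim S"
    by (rule real_vector.basis_exists)
  have span: "span B = span S"
    using B by (metis span_mono span_minimal subspace_span subset_antisym)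
  have "dim (f ` S) = card (f ` B)"
  proof (rule real_vector.dim_eq_card)
    show "span (f ` B) = span (f ` S)"
      by (simp add: linear_span_image[OF assms(1)] span)
    show "independent (f ` B)"
      using linear_independent_injective_image[OF assms(1) B(2)] assms(2) span by simp
  qed
  also have "\<dots> = card B"
    using assms(2) B(1) span_superset by (intro card_image) (blast intro: inj_on_subset)
  finally show ?thesis using B by simp
qed

text \<open>\<open>F\<close> is linear only on \<open>S\<close>, so
  \<open>\<xi> \<mapsto> (F \<xi>, \<xi>)\<close> need not be linear on the whole type. The
  projection \<open>snd\<close> is, and it is injective on the graph, which is its own span.\<close>

lemma dim_graph_over:
  assumes S: "subspace S"
    and add: "\<And>\<xi> \<eta>. \<xi> \<in> S \<Longrightarrow> \<eta> \<in> S \<Longrightarrow> F (\<xi> + \<eta>) = F \<xi> + F \<eta>"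
    and scale: "\<And>c \<xi>. \<xi> \<in> S \<Longrightarrow> F (c *\<^sub>R \<xi>) = c *\<^sub>R F \<xi>"
  shows "dim (graph_over F S) = dim S"
proof -
  have F0: "F 0 = 0"
    using scale[of 0 0] subspace_0[OF S] by simp
  have "subspace (graph_over F S)"
    unfolding subspace_def graph_over_def
  proof (intro conjI ballI allI)
    show "0 \<in> (\<lambda>\<xi>. (F \<xi>, \<xi>)) ` S"
      using subspace_0[OF S] F0 by (auto simp: image_iff zero_prod_def)
  qed (auto simp: image_iff add scale subspace_add[OF S] subspace_scale[OF S])
  then have "span (graph_over F S) = graph_over F S"
    by (rule real_vector.span_eq_iff[THEN iffD2])
  moreover have "inj_on snd (graph_over F S)"
    by (auto simp: graph_over_def inj_on_def)
  ultimately have "dim (snd ` graph_over F S) = dim (graph_over F S)"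
    by (metis dim_image_inj_on linear_snd)
  moreover have "snd ` graph_over F S = S"
    by (force simp: graph_over_def)
  ultimately show ?thesis by simp
qed

section \<open>The real part of the graph\<close>

lemma real_part_cgraph:
  assumes M: "smooth_manifold M" and \<pi>: "cbivector_field M \<pi>" "has_real_imag_parts M \<pi> \<pi>1 \<pi>2"
    and p: "p \<in> points M" and b1: "bivector_at M p (\<pi>1 p)" and b2: "bivector_at M p (\<pi>2 p)"
  shows "real_part M (cgraph M \<pi>) p = graph_over (sharp M p (\<pi>1 p)) (ker_sharp M p (\<pi>2 p))"
proof -
  have zero: "0 \<in> cotangent_space M p"
    by (rule subspace_0[OF subspace_cotangent_space])
  have cs: "csharp M p (\<pi> p) (\<xi>, 0) = (sharp M p (\<pi>1 p) \<xi>, sharp M p (\<pi>2 p) \<xi>)"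
    if "\<xi> \<in> cotangent_space M p" for \<xi>
    using csharp_real_imag[OF \<pi> p that zero] by (simp add: sharp_zero[OF b1] sharp_zero[OF b2])
  \<comment> \<open>The zero imaginary part is a pair: its covector entry puts the argument in the
    form \<open>(\<xi>, 0)\<close> of \<open>cs\<close>, and its vector entry gives the kernel
    condition.\<close>
  have mem: "of_real_vector (X, \<xi>) \<in> cgraph M \<pi> p \<longleftrightarrow>
      \<xi> \<in> ker_sharp M p (\<pi>2 p) \<and> X = sharp M p (\<pi>1 p) \<xi>" for X \<xi>
    using zero cs[of \<xi>]
    by (auto simp: of_real_vector_def cgraph_def complexification_def zero_prod_def ker_sharp_def)
  have "(sharp M p (\<pi>1 p) \<xi>, \<xi>) \<in> gen_tangent_space M p" if "\<xi> \<in> ker_sharp M p (\<pi>2 p)" for \<xi>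
    using that sharp_in_tangent_space[OF M b1]
    by (simp add: gen_tangent_space_def ker_sharp_def)
  then show ?thesis
    by (auto simp: real_part_def graph_over_def mem)
qed

theorem lemma8p2:
  fixes M :: "'a manifold" and \<pi> :: "'a \<Rightarrow> 'a cbivec" and \<pi>1 \<pi>2 :: "'a \<Rightarrow> 'a bivec"
  assumes "smooth_manifold M"
    and "cbivector_field M \<pi>"
    and "bivector_field M \<pi>1" and "bivector_field M \<pi>2"
    and "has_real_imag_parts M \<pi> \<pi>1 \<pi>2"
  shows "\<forall>p\<in>points M.
     real_part M (cgraph M \<pi>) p = graph_over (sharp M p (\<pi>1 p)) (ker_sharp M p (\<pi>2 p)) \<and>
     real_part M (cgraph M \<pi>) p = {(sharp M p (\<pi>1 p) \<xi>, \<xi>) | \<xi>. \<xi> \<in> ker_sharp M p (\<pi>2 p)} \<and>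
     real_part M (cgraph M \<pi>) p = exp_bivector M p (\<pi>1 p) ({0} \<times> ker_sharp M p (\<pi>2 p)) \<and>
     real_index M (cgraph M \<pi>) p = dim (ker_sharp M p (\<pi>2 p))"
proof
  fix p assume p: "p \<in> points M"
  have b1: "bivector_at M p (\<pi>1 p)" and b2: "bivector_at M p (\<pi>2 p)"
    using assms(3,4) p by (simp_all add: bivector_field_def)
  let ?G = "graph_over (sharp M p (\<pi>1 p)) (ker_sharp M p (\<pi>2 p))"
  have "real_part M (cgraph M \<pi>) p = ?G"
    by (rule real_part_cgraph[OF assms(1,2,5) p b1 b2])
  moreover have "?G = {(sharp M p (\<pi>1 p) \<xi>, \<xi>) | \<xi>. \<xi> \<in> ker_sharp M p (\<pi>2 p)}"
    by (auto simp: graph_over_def)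
  \<comment> \<open>The factor \<open>{0}\<close> regards covectors as generalized vectors with no
    tangent part.\<close>
  moreover have "?G = exp_bivector M p (\<pi>1 p) ({0} \<times> ker_sharp M p (\<pi>2 p))"
    by (auto simp: graph_over_def exp_bivector_def)
  moreover have "dim ?G = dim (ker_sharp M p (\<pi>2 p))"
    by (rule dim_graph_over[OF subspace_ker_sharp[OF b2]])
      (simp_all add: ker_sharp_def sharp_add[OF b1] sharp_scaleR[OF b1])
  ultimately show "real_part M (cgraph M \<pi>) p = ?G \<and>
     real_part M (cgraph M \<pi>) p = {(sharp M p (\<pi>1 p) \<xi>, \<xi>) | \<xi>. \<xi> \<in> ker_sharp M p (\<pi>2 p)} \<and>
     real_part M (cgraph M \<pi>) p = exp_bivector M p (\<pi>1 p) ({0} \<times> ker_sharp M p (\<pi>2 p)) \<and>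
     real_index M (cgraph M \<pi>) p = dim (ker_sharp M p (\<pi>2 p))"
    by (simp add: real_index_def)
qed

end
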